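(* Fix $n\ge1$. For all integers $m,k\ge1$, $$c_{n,m,k}(1)=b_{n,k}\binom{m-1}{k-1}.$$
   Context: Words are finite sequences of positive integers; $|w|$ is the length of $w$. $P(w)$ is the insertion tableau of $w$ under the Robinson–Schensted–Knuth (row-insertion) correspondence, and $C(u)=\{w : P(uw)=P(wu)\}$ (juxtaposition is concatenation). Define $c_{n,m,k}(u)$ as the number of $w\in C(u)$ with $|w|=n$, $\max w\le m$, and exactly $k$ distinct letters in $w$. A word $w$ is $k$-packed if $\max w=k$ and every element of $\{1,\dots,k\}$ occurs in $w$. Let $b_{n,k}$ be the number of $k$-packed words $w\in C(1)$ with $|w|=n$. *)

theory Defs
  imports Main
begin

text \<open>Words over the positive integers are lists of natural numbers not containing 0.\<close>

definition words :: "nat list set" where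
  "words = {w. 0 \<notin> set w}"

text \<open>
  Row insertion: the leftmost entry strictly greater than \<open>x\<close> is replaced by \<open>x\<close> and bumped;
  if there is none, \<open>x\<close> is appended and nothing is bumped.
\<close>

fun row_insert :: "nat \<Rightarrow> nat list \<Rightarrow> nat list \<times> nat option" where
  "row_insert x [] = ([x], None)"
| "row_insert x (y # ys) =
    (if x < y then (x # ys, Some y)
     else (case row_insert x ys of (ys', b) \<Rightarrow> (y # ys', b)))"

text \<open>A tableau is the list of its rows; the row into which letters are inserted first is the head.\<close>

fun tableau_insert :: "nat \<Rightarrow> nat list list \<Rightarrow> nat list list" where
  "tableau_insert x [] = [[x]]"
| "tableau_insert x (r # rs) =
    (case row_insert x r of
       (r', None) \<Rightarrow> r' # rs
     | (r', Some y) \<Rightarrow> r' # tableau_insert y rs)"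

definition insertion_tableau :: "nat list \<Rightarrow> nat list list" where
  "insertion_tableau w = foldl (\<lambda>T x. tableau_insert x T) [] w"

definition C :: "nat list \<Rightarrow> nat list set" where
  "C u = {w \<in> words. insertion_tableau (u @ w) = insertion_tableau (w @ u)}"

text \<open>The maximum of the empty word is taken to be 0.\<close>

definition max_letter :: "nat list \<Rightarrow> nat" where
  "max_letter w = Max (insert 0 (set w))"

definition packed :: "nat \<Rightarrow> nat list \<Rightarrow> bool" where
  "packed k w \<longleftrightarrow> w \<in> words \<and> max_letter w = k \<and> {1..k} \<subseteq> set w"

definition c :: "nat \<Rightarrow> nat \<Rightarrow> nat \<Rightarrow> nat list \<Rightarrow> nat" where
  "c n m k u = card {w \<in> C u. length w = n \<and> max_letter w \<le> m \<and> card (set w) = k}"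

definition b :: "nat \<Rightarrow> nat \<Rightarrow> nat" where
  "b n k = card {w \<in> C [1]. packed k w \<and> length w = n}"

end

theory Submission
  imports Defs
begin

text \<open>
  A nonempty word of \<open>C [1]\<close> must contain the letter 1: if all letters of \<open>w\<close> exceed 1, then the
  first row of the tableau of \<open>1w\<close> is one longer than that of \<open>w\<close>, whereas inserting 1 last bumps
  the first entry and keeps the length of the first row. Insertion commutes with strictly increasing
  relabellings of the letters, so the words of \<open>C [1]\<close> with a given support \<open>S\<close> of size \<open>k\<close> with
  \<open>1 \<in> S\<close> correspond to the \<open>k\<close>-packed ones; it remains to count the supports.
\<close>

section \<open>Relabelling letters by a strictly increasing map\<close>

text \<open>Row insertion only compares letters, so it cannot distinguish a row from its
  order-preserving image.\<close>

lemma row_insert_map: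
  assumes "strict_mono f"
  shows "row_insert (f x) (map f r) = map_prod (map f) (map_option f) (row_insert x r)"
  by (induction r) (auto simp: strict_mono_less[OF assms] split: prod.splits)

lemma tableau_insert_map:
  assumes "strict_mono f"
  shows "tableau_insert (f x) (map (map f) T) = map (map f) (tableau_insert x T)"
  by (induction T arbitrary: x)
    (auto simp: row_insert_map[OF assms] split: prod.splits option.splits)

lemma insertion_tableau_map:
  assumes "strict_mono f"
  shows "insertion_tableau (map f w) = map (map f) (insertion_tableau w)"
proof -
  have "foldl (\<lambda>T x. tableau_insert x T) (map (map f) T) (map f w)
      = map (map f) (foldl (\<lambda>T x. tableau_insert x T) T w)" for T
    by (induction w arbitrary: T) (simp_all add: tableau_insert_map[OF assms])
  from this[of "[]"] show ?thesis by (simp add: insertion_tableau_def)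
qed

text \<open>Injectivity of \<open>f\<close> lifts to tableaux, so equality of tableaux is reflected
  as well as preserved. Fixing 0 ensures that \<open>map f w\<close> avoids 0 exactly when
  \<open>w\<close> does.\<close>

lemma map_in_C_iff:
  assumes "strict_mono f" "f 0 = 0"
  shows "map f w \<in> C (map f u) \<longleftrightarrow> w \<in> C u"
proof -
  have inj: "inj f" using assms(1) by (rule strict_mono_imp_inj_on)
  have "0 \<in> f ` set w \<longleftrightarrow> 0 \<in> set w"
    using inj_image_mem_iff[OF inj, of 0] assms(2) by simp
  moreover have "insertion_tableau (map f u @ map f w) = insertion_tableau (map f w @ map f u)
      \<longleftrightarrow> insertion_tableau (u @ w) = insertion_tableau (w @ u)"
    using inj_mapI[OF inj_mapI[OF inj]]
    by (simp add: insertion_tableau_map[OF assms(1)] inj_eq flip: map_append)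
  ultimately show ?thesis by (simp add: C_def words_def)
qed

section \<open>Words commuting with a smaller letter\<close>

lemma set_row_insert: "set (fst (row_insert x r)) \<subseteq> insert x (set r)"
  by (induction r) (auto split: prod.splits)

lemma row_insert_nonempty: "fst (row_insert x r) \<noteq> []"
  by (cases r) (auto split: prod.splits)

text \<open>Insertion of \<open>x\<close> passes over the smaller head \<open>a\<close> and then
  acts on \<open>r\<close> as if \<open>a\<close> were absent. The same letter is bumped in both
  cases, so the lower rows agree.\<close>

lemma tableau_insert_Cons_less:
  assumes "a < x" "\<forall>y\<in>set r. a < y"
  obtains r' rs' where "tableau_insert x (r # rs) = r' # rs'"
    "tableau_insert x ((a # r) # rs) = (a # r') # rs'" "\<forall>y\<in>set r'. a < y" "r' \<noteq> []"
proof -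
  obtain r' z where r': "row_insert x r = (r', z)" by fastforce
  have "\<forall>y\<in>set r'. a < y" "r' \<noteq> []"
    using set_row_insert[of x r] row_insert_nonempty[of x r] assms r' by auto
  with that assms(1) r' show thesis by (cases z) auto
qed

lemma foldl_tableau_insert_Cons_less:
  assumes "\<forall>y\<in>set w. a < y" "\<forall>y\<in>set r. a < y" "w \<noteq> [] \<or> r \<noteq> []"
  shows "\<exists>r' rs'. foldl (\<lambda>T x. tableau_insert x T) (r # rs) w = r' # rs'
    \<and> foldl (\<lambda>T x. tableau_insert x T) ((a # r) # rs) w = (a # r') # rs'
    \<and> (\<forall>y\<in>set r'. a < y) \<and> r' \<noteq> []"
  using assms
proof (induction w arbitrary: r rs)
  case Nil
  then show ?case by simp
next
  case (Cons x w)
  obtain r' rs' where "tableau_insert x (r # rs) = r' # rs'"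
    "tableau_insert x ((a # r) # rs) = (a # r') # rs'" "\<forall>y\<in>set r'. a < y" "r' \<noteq> []"
    using tableau_insert_Cons_less[of a x r rs] Cons.prems by auto
  with Cons.IH[of r' rs'] Cons.prems show ?case by simp
qed

lemma C_singleton_not_all_greater:
  assumes "w \<in> C [a]" "w \<noteq> []"
  shows "\<not> (\<forall>y\<in>set w. a < y)"
proof
  assume less: "\<forall>y\<in>set w. a < y"
  \<comment> \<open>After the first letter \<open>x\<close>, both starting tableaux become
    \<open>[[x]]\<close>; the empty row provides the form \<open>r # rs\<close> that the comparison
    lemma expects.\<close>
  have start: "foldl (\<lambda>T x. tableau_insert x T) [] w = foldl (\<lambda>T x. tableau_insert x T) [[]] w"
    using assms(2) by (cases w) auto
  obtain r' rs' where w: "foldl (\<lambda>T x. tableau_insert x T) [[]] w = r' # rs'"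
    and aw: "foldl (\<lambda>T x. tableau_insert x T) [[a]] w = (a # r') # rs'"
    and r': "\<forall>y\<in>set r'. a < y" "r' \<noteq> []"
    using foldl_tableau_insert_Cons_less[OF less, of "[]" "[]"] assms(2) by auto
  have "tableau_insert a (r' # rs') = (a # r') # rs'"
    using assms(1) by (simp add: C_def insertion_tableau_def start w aw)
  \<comment> \<open>The head of \<open>r'\<close> exceeds \<open>a\<close>, so inserting
    \<open>a\<close> overwrites it and keeps the row length, while \<open>a # r'\<close> is longer
    by one.\<close>
  with r' show False by (cases r') auto
qed

lemma one_in_set_C_one:
  assumes "w \<in> C [1]" "w \<noteq> []"
  shows "1 \<in> set w"
proof -
  obtain y where "y \<in> set w" "y \<le> 1"
    using C_singleton_not_all_greater[OF assms] by (auto simp: not_less)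
  moreover have "0 \<notin> set w" using assms(1) by (simp add: C_def words_def)
  ultimately have "y = 1" by (metis le_eq_less_or_eq less_one)
  with \<open>y \<in> set w\<close> show ?thesis by simp
qed

section \<open>Packed words and words with a given support\<close>

text \<open>The increasing enumeration of \<open>S\<close> is extended to all of \<open>nat\<close>
  with 0 fixed, as \<open>map_in_C_iff\<close> demands. The induction adds a new maximum at each
  step.\<close>

lemma strict_mono_enumeration:
  fixes S :: "nat set"
  assumes "finite S" "0 \<notin> S"
  obtains f where "strict_mono f" "f 0 = (0::nat)" "f ` {1..card S} = S"
proof -
  from assms have "\<exists>f::nat \<Rightarrow> nat. strict_mono f \<and> f 0 = 0 \<and> f ` {1..card S} = S"
  proof (induction S rule: finite_linorder_max_induct)
    case empty
    show ?case by (rule exI[of _ id]) (simp add: strict_mono_def)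
  next
    case (insert s A)
    then obtain f where f: "strict_mono f" "f 0 = 0" "f ` {1..card A} = A" by auto
    \<comment> \<open>The first free index goes to the new maximum \<open>s\<close>; later indices
      continue with \<open>s + 1\<close>, \<open>s + 2\<close> and so on, which keeps the map
      strictly increasing everywhere.\<close>
    let ?g = "\<lambda>i. if i \<le> card A then f i else s + (i - Suc (card A))"
    have f_less: "f i < s" if "i \<le> card A" for i
    proof (cases "i = 0")
      case True
      with f insert.prems show ?thesis by simp
    next
      case False
      with that have "f i \<in> A" using f(3) by force
      with insert.hyps show ?thesis by blast
    qed
    have "strict_mono ?g"
    proof (rule strict_monoI)
      fix i j :: nat
      assume "i < j"
      then show "?g i < ?g j"
        using strict_monoD[OF f(1), of i j] f_less[of i] by (auto simp: trans_less_add1)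
    qed
    moreover have "?g ` {1..Suc (card A)} = insert s A"
    proof -
      have "?g ` {1..card A} = f ` {1..card A}" by (intro image_cong) auto
      moreover have "{1..Suc (card A)} = insert (Suc (card A)) {1..card A}" by auto
      ultimately have "?g ` {1..Suc (card A)} = insert (?g (Suc (card A))) A"
        using f(3) by (simp only: image_insert)
      then show ?thesis by simp
    qed
    moreover have "card (insert s A) = Suc (card A)"
      using insert.hyps by (intro card_insert_disjoint) auto
    ultimately show ?case using f(2) by (intro exI[of _ ?g]) auto
  qed
  with that show thesis by blast
qed

lemma max_letter_le_iff: "max_letter w \<le> m \<longleftrightarrow> (\<forall>x\<in>set w. x \<le> m)"
  by (simp add: max_letter_def)

lemma packed_iff:
  assumes "k \<ge> 1"
  shows "packed k w \<longleftrightarrow> set w = {1..k}"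
proof
  assume w: "packed k w"
  then have "\<forall>x\<in>set w. x \<le> k" "0 \<notin> set w"
    using max_letter_le_iff[of w k] by (auto simp: packed_def words_def)
  then have "set w \<subseteq> {1..k}" by (auto simp: Suc_le_eq intro: gr0I)
  with w show "set w = {1..k}" by (auto simp: packed_def)
next
  assume w: "set w = {1..k}"
  then have "max_letter w = k"
    unfolding max_letter_def using assms by (intro Max_eqI) auto
  with w show "packed k w" by (simp add: packed_def words_def)
qed

lemma card_C_one_support:
  assumes "finite S" "0 \<notin> S" "1 \<in> S"
  shows "card {w \<in> C [1]. set w = S \<and> length w = n} = b n (card S)"
proof -
  obtain f where f: "strict_mono f" "f 0 = 0" "f ` {1..card S} = S"
    using strict_mono_enumeration[OF assms(1,2)] by blast
  have inj: "inj f" using f(1) by (rule strict_mono_imp_inj_on)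
  \<comment> \<open>Since 1 is the least element of \<open>S\<close>, the relabelling fixes the word
    \<open>[1]\<close>, so it carries \<open>C [1]\<close> to itself.\<close>
  have "f 1 = 1"
  proof -
    obtain i where i: "i \<ge> 1" "f i = 1" using f(3) assms(3) by force
    have "f 0 < f 1" using f(1) by (simp add: strict_mono_less)
    moreover have "f 1 \<le> f i" using i(1) f(1) by (simp add: strict_mono_less_eq)
    ultimately show ?thesis using i(2) by simp
  qed
  then have C_iff: "map f w \<in> C [1] \<longleftrightarrow> w \<in> C [1]" for w
    using map_in_C_iff[OF f(1,2), of w "[1]"] by simp
  have set_iff: "set (map f w) = S \<longleftrightarrow> set w = {1..card S}" for w
    using inj_image_eq_iff[OF inj, of "set w" "{1..card S}"] f(3) by simp
  have "card S \<ge> 1" using assms by (auto simp: Suc_le_eq card_gt_0_iff)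
  then have "{w \<in> C [1]. packed (card S) w \<and> length w = n}
      = {w \<in> C [1]. set w = {1..card S} \<and> length w = n}" (is "_ = ?A")
    by (simp add: packed_iff)
  moreover have "map f ` ?A = {w \<in> C [1]. set w = S \<and> length w = n}" (is "_ = ?B")
  proof
    show "map f ` ?A \<subseteq> ?B" using C_iff f(3) by auto
    show "?B \<subseteq> map f ` ?A"
    proof
      fix w assume w: "w \<in> ?B"
      then have "\<forall>y\<in>set w. \<exists>x. y = f x" using f(3) by auto
      then obtain v where "w = map f v" unfolding ex_map_conv[symmetric] by blast
      with w show "w \<in> map f ` ?A" using C_iff set_iff by auto
    qed
  qed
  ultimately show ?thesis
    using card_image[OF inj_on_subset[OF inj_mapI[OF inj] subset_UNIV], of ?A] by (simp add: b_def)
qed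

section \<open>Counting supports and summing over them\<close>

text \<open>The element 1 is forced, so the other \<open>k - 1\<close> elements are chosen freely
  from the \<open>m - 1\<close> elements of \<open>{2..m}\<close>.\<close>

lemma card_supports:
  assumes "m \<ge> 1" "k \<ge> 1"
  shows "card {S. S \<subseteq> {1..m} \<and> 1 \<in> S \<and> card S = k} = (m - 1) choose (k - 1)"
proof -
  let ?A = "{S. S \<subseteq> {2..m} \<and> card S = k - 1}"
  have "insert 1 ` ?A = {S. S \<subseteq> {1..m} \<and> 1 \<in> S \<and> card S = k}" (is "_ = ?B")
  proof
    have "card (insert 1 S) = k" if "S \<in> ?A" for S
      using that assms(2) finite_subset[of S "{2..m}"]
      by (subst card_insert_disjoint) auto
    then show "insert 1 ` ?A \<subseteq> ?B" using assms(1) by auto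
    show "?B \<subseteq> insert 1 ` ?A"
    proof
      fix S assume S: "S \<in> ?B"
      have "S - {1} \<subseteq> {2..m}"
      proof
        fix x assume "x \<in> S - {1}"
        then have "x \<in> {1..m}" "x \<noteq> 1" using S by auto
        then show "x \<in> {2..m}" by auto
      qed
      moreover have "card (S - {1}) = k - 1" using S by (subst card_Diff_singleton) auto
      moreover have "S = insert 1 (S - {1})" using S by auto
      ultimately show "S \<in> insert 1 ` ?A" by blast
    qed
  qed
  moreover have "inj_on (insert 1) ?A"
  proof (rule inj_onI)
    fix S T assume "S \<in> ?A" "T \<in> ?A" and eq: "insert 1 S = insert 1 T"
    then have "1 \<notin> S" "1 \<notin> T" by auto
    with eq show "S = T" by (simp add: insert_ident)
  qed
  ultimately have "card ?B = card ?A" using card_image[of "insert 1" ?A] by (simp only:)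
  also have "\<dots> = card {2..m} choose (k - 1)" by (rule n_subsets) simp
  finally show ?thesis by (simp only: card_atLeastAtMost) simp
qed

theorem theorem4p3:
  fixes n m k :: nat
  assumes "n \<ge> 1" and "m \<ge> 1" and "k \<ge> 1"
  shows "c n m k [1] = b n k * ((m - 1) choose (k - 1))"
proof -
  let ?Supp = "{S. S \<subseteq> {1..m} \<and> 1 \<in> S \<and> card S = k}"
  let ?W = "\<lambda>S. {w \<in> C [1]. set w = S \<and> length w = n}"
  have fin_Supp: "finite ?Supp" by simp
  have "{w \<in> C [1]. length w = n \<and> max_letter w \<le> m \<and> card (set w) = k} = (\<Union>S\<in>?Supp. ?W S)"
  proof -
    \<comment> \<open>This is where \<open>n \<ge> 1\<close> enters: it makes \<open>w\<close>
      nonempty, hence forces the letter 1 into the support.\<close>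
    have *: "max_letter w \<le> m \<longleftrightarrow> set w \<subseteq> {1..m} \<and> 1 \<in> set w"
      if w: "w \<in> C [1]" "length w = n" for w
    proof -
      have "w \<noteq> []" using w(2) assms(1) by auto
      with w(1) have "1 \<in> set w" by (rule one_in_set_C_one)
      moreover have "0 \<notin> set w" using w(1) by (simp add: C_def words_def)
      then have "set w \<subseteq> {1..m} \<longleftrightarrow> (\<forall>x\<in>set w. x \<le> m)"
        by (auto simp: subset_iff Suc_le_eq intro: gr0I)
      ultimately show ?thesis by (simp add: max_letter_le_iff)
    qed
    show ?thesis
    proof (rule set_eqI)
      fix w
      have "w \<in> (\<Union>S\<in>?Supp. ?W S) \<longleftrightarrow> w \<in> C [1] \<and> length w = n \<and> set w \<in> ?Supp" by blast
      then show "w \<in> {w \<in> C [1]. length w = n \<and> max_letter w \<le> m \<and> card (set w) = k}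
          \<longleftrightarrow> w \<in> (\<Union>S\<in>?Supp. ?W S)"
        using *[of w] by blast
    qed
  qed
  then have "c n m k [1] = card (\<Union>S\<in>?Supp. ?W S)" by (simp add: c_def)
  also have "\<dots> = (\<Sum>S\<in>?Supp. card (?W S))"
  proof (rule card_UN_disjoint[OF fin_Supp])
    show "\<forall>S\<in>?Supp. finite (?W S)"
    proof
      fix S assume "S \<in> ?Supp"
      then have "finite S" using finite_subset by blast
      \<comment> \<open>The words in \<open>?W S\<close> have fixed length over the finite alphabet
        \<open>S\<close>.\<close>
      then show "finite (?W S)"
        by (rule finite_subset[OF _ finite_lists_length_eq[of S n], rotated]) auto
    qed
  qed auto
  also have "\<dots> = (\<Sum>S\<in>?Supp. b n k)"
  proof (rule sum.cong[OF refl])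
    fix S assume S: "S \<in> ?Supp"
    then have "finite S" using finite_subset by blast
    moreover have "0 \<notin> S" "1 \<in> S" "card S = k" using S by auto
    ultimately show "card (?W S) = b n k" using card_C_one_support by blast
  qed
  also have "\<dots> = b n k * ((m - 1) choose (k - 1))"
    using card_supports[OF assms(2,3)] by simp
  finally show ?thesis .
qed

end
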